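(* Consider a GraphCNN with decomposition $\mathbf{A}=\sum_{k=1}^K\mathbf{A}_k$ ($\mathbf{A},\mathbf{A}_k\in\mathbb{R}^{n\times n}$), weight matrices $\mathbf{W}_k^{(i)}\in\mathbb{R}^{d\times d}$ ($1\le k\le K$, $i\in\mathbb{N}^+$), and parametric ReLU activation $\sigma(t)=\max(t,at)$, $a\in(0,1)$, with random input $\mathbf{x}$, layer-$l$ output $\mathbf{y}^{(l)}$ (both vectorized), and diagonal mask matrices $\mathbf{P}^{(i)}$ as defined in the context. Let $$\sigma^{(i)}=\max_j\lambda_j\Big(\mathbf{P}^{(i)}\sum_{k=1}^K\big((\mathbf{W}_k^{(i)})^T\otimes\mathbf{A}_k\big)\Big).$$ If $\sup_{i\in\mathbb{N}^+}\sigma^{(i)}<1$ (for every value of the input, the supremum being taken also over input values), then $\mathcal{I}(\mathbf{x};\mathbf{y}^{(l)})=\mathcal{O}\big((\sup_{i\in\mathbb{N}^+}\sigma^{(i)})^l\big)$ (as $l\to\infty$), and hence $\lim_{l\to\infty}\mathcal{I}(\mathbf{x};\mathbf{y}^{(l)})=0$.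
   Context: $\lambda_j(\cdot)$ denotes the $j$-th singular value of a matrix and $\otimes$ the Kronecker product. The input $\mathbf{X}\in\mathbb{R}^{n\times d}$ is a random matrix; set $\mathbf{Y}^{(0)}=\mathbf{X}$. The GraphCNN is defined by $\mathbf{Y}^{(i+1)}=\sigma\big(\sum_{k=1}^K\mathbf{A}_k\mathbf{Y}^{(i)}\mathbf{W}_k^{(i+1)}\big)$, $i\ge0$, with $\sigma$ applied entrywise and deterministic matrices $\mathbf{A}_k,\mathbf{W}_k^{(i)}$. $\mathbf{A}$ is the adjacency matrix of an undirected graph on $n$ nodes. $\mathbf{x}$ and $\mathbf{y}^{(l)}$ are the column-stacking vectorizations of $\mathbf{X}$ and $\mathbf{Y}^{(l)}$ (with $\mathbf{y}^{(0)}=\mathbf{x}$). $\mathbf{P}^{(i+1)}$ is the $nd\times nd$ diagonal matrix with $(\mathbf{P}^{(i+1)})_{j,j}=1$ if $\big(\sum_{k}((\mathbf{W}_k^{(i+1)})^T\otimes\mathbf{A}_k)\mathbf{y}^{(i)}\big)_j\ge0$ and $(\mathbf{P}^{(i+1)})_{j,j}=a$ otherwise, so that $\mathbf{y}^{(i+1)}=\mathbf{P}^{(i+1)}\sum_k((\mathbf{W}_k^{(i+1)})^T\otimes\mathbf{A}_k)\mathbf{y}^{(i)}$; it depends on the input value. All random vectors have entries in finite alphabets (finite sets of reals); $\mathcal{I}(\cdot;\cdot)$ is Shannon mutual information.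
   Formalization: One finite alphabet is assumed to contain the entries of the input and of all layer outputs; with a separate alphabet per layer the claim fails (n=d=K=1, A=1, W=1/2, x uniform on {0,1}: the mutual information stays log 2). *)

theory Defs
  imports "HOL-Probability.Probability"
begin

text \<open>
  Nodes are indexed by \<open>'n\<close> and feature channels by \<open>'d\<close>, so \<open>real^'d^'n\<close> is the type of
  \<open>n \<times> d\<close> matrices. Column stacking puts entry \<open>(i, j)\<close> of an \<open>n \<times> d\<close> matrix at position
  \<open>(j, i)\<close>; with the lexicographic order on pairs this is the usual order, column by column.
\<close>

definition vec_cols :: "real^'d^'n \<Rightarrow> real^('d \<times> 'n)" where
  "vec_cols X = (\<chi> p. X $ snd p $ fst p)"

definition kronecker :: "real^'b^'a \<Rightarrow> real^'d^'c \<Rightarrow> real^('b \<times> 'd)^('a \<times> 'c)"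
    (infixl \<open>\<otimes>\<^sub>K\<close> 75) where
  "B \<otimes>\<^sub>K C = (\<chi> p q. B $ fst p $ fst q * C $ snd p $ snd q)"

text \<open>
  The square roots of the eigenvalues of \<open>M\<^sup>T M\<close>, collected as a set: multiplicities play no role
  for the largest singular value.
\<close>

definition singular_values :: "real^'m^'k \<Rightarrow> real set" where
  "singular_values M =
     {sqrt \<mu> | \<mu>. \<exists>v. v \<noteq> 0 \<and> (transpose M ** M) *v v = \<mu> *\<^sub>R v}"

text \<open>Self-loops are allowed.\<close>

definition undirected_adjacency :: "real^'n^'n \<Rightarrow> bool" where
  "undirected_adjacency A \<longleftrightarrow> transpose A = A \<and> (\<forall>i j. A $ i $ j \<in> {0, 1})"

definition prelu :: "real \<Rightarrow> real \<Rightarrow> real" where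
  "prelu a t = max t (a * t)"

text \<open>\<open>A k\<close> is the \<open>k\<close>-th summand of the adjacency matrix and \<open>W i k\<close> its weight matrix in layer \<open>i \<ge> 1\<close>.\<close>

fun graph_cnn :: "real \<Rightarrow> nat \<Rightarrow> (nat \<Rightarrow> real^'n^'n) \<Rightarrow> (nat \<Rightarrow> nat \<Rightarrow> real^'d^'d) \<Rightarrow>
    real^'d^'n \<Rightarrow> nat \<Rightarrow> real^'d^'n" where
  "graph_cnn a K A W X 0 = X"
| "graph_cnn a K A W X (Suc i) =
     map_matrix (prelu a) (\<Sum>k = 1..K. A k ** graph_cnn a K A W X i ** W (Suc i) k)"

definition layer_matrix :: "nat \<Rightarrow> (nat \<Rightarrow> real^'n^'n) \<Rightarrow> (nat \<Rightarrow> nat \<Rightarrow> real^'d^'d) \<Rightarrow>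
    nat \<Rightarrow> real^('d \<times> 'n)^('d \<times> 'n)" where
  "layer_matrix K A W i = (\<Sum>k = 1..K. transpose (W i k) \<otimes>\<^sub>K A k)"

text \<open>Only meaningful for layers \<open>i \<ge> 1\<close>; it depends on the input value \<open>X\<close>.\<close>

definition mask_matrix :: "real \<Rightarrow> nat \<Rightarrow> (nat \<Rightarrow> real^'n^'n) \<Rightarrow> (nat \<Rightarrow> nat \<Rightarrow> real^'d^'d) \<Rightarrow>
    real^'d^'n \<Rightarrow> nat \<Rightarrow> real^('d \<times> 'n)^('d \<times> 'n)" where
  "mask_matrix a K A W X i =
     (\<chi> p q. if p = q
             then (if (layer_matrix K A W i *v vec_cols (graph_cnn a K A W X (i - 1))) $ p \<ge> 0
                   then 1 else a)
             else 0)"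

definition layer_sigma :: "real \<Rightarrow> nat \<Rightarrow> (nat \<Rightarrow> real^'n^'n) \<Rightarrow> (nat \<Rightarrow> nat \<Rightarrow> real^'d^'d) \<Rightarrow>
    real^'d^'n \<Rightarrow> nat \<Rightarrow> real" where
  "layer_sigma a K A W X i = Max (singular_values (mask_matrix a K A W X i ** layer_matrix K A W i))"

text \<open>
  The locale abbreviation for the mutual information of finite-valued random variables
  with logarithms to base \<open>b\<close>, made available outside its locale.
\<close>

abbreviation shannon_mutual_information ::
    "'a measure \<Rightarrow> real \<Rightarrow> ('a \<Rightarrow> 'b) \<Rightarrow> ('a \<Rightarrow> 'c) \<Rightarrow> real" where
  "shannon_mutual_information M b X Y \<equiv>
     prob_space.mutual_information M b (count_space (X ` space M)) (count_space (Y ` space M)) X Y"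

text \<open>The vectorized recursion agrees with the matrix one.\<close>

lemma kronecker_mult_vec_cols:
  fixes A :: "real^'n^'n" and Y :: "real^'d^'n" and W :: "real^'d^'d"
  shows "(transpose W \<otimes>\<^sub>K A) *v vec_cols Y = vec_cols (A ** Y ** W)"
proof (rule vec_eq_iff[THEN iffD2], rule allI)
  fix p :: "'d \<times> 'n"
  have "((transpose W \<otimes>\<^sub>K A) *v vec_cols Y) $ p =
      (\<Sum>j\<in>UNIV. \<Sum>i\<in>UNIV. W $ j $ fst p * A $ snd p $ i * Y $ i $ j)"
    by (simp add: matrix_vector_mult_def kronecker_def vec_cols_def transpose_def
        sum.cartesian_product split_beta flip: UNIV_Times_UNIV)
  also have "\<dots> = vec_cols (A ** Y ** W) $ p"
    by (simp add: vec_cols_def matrix_matrix_mult_def sum_distrib_right sum_distrib_left mult_ac)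
  finally show "((transpose W \<otimes>\<^sub>K A) *v vec_cols Y) $ p = vec_cols (A ** Y ** W) $ p" .
qed

lemma layer_matrix_mult_vec_cols:
  "layer_matrix K A W i *v vec_cols Y = vec_cols (\<Sum>k = 1..K. A k ** Y ** W i k)"
proof -
  have "layer_matrix K A W i *v vec_cols Y = (\<Sum>k = 1..K. (transpose (W i k) \<otimes>\<^sub>K A k) *v vec_cols Y)"
    unfolding layer_matrix_def
    by (induction K) (simp_all add: matrix_vector_mult_add_rdistrib)
  also have "\<dots> = vec_cols (\<Sum>k = 1..K. A k ** Y ** W i k)"
    by (simp add: kronecker_mult_vec_cols) (simp add: vec_cols_def vec_eq_iff)
  finally show ?thesis .
qed

lemma vec_cols_graph_cnn_Suc:
  assumes "0 < a" "a < 1"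
  shows "vec_cols (graph_cnn a K A W X (Suc i)) =
    (mask_matrix a K A W X (Suc i) ** layer_matrix K A W (Suc i)) *v vec_cols (graph_cnn a K A W X i)"
proof -
  define v where "v = layer_matrix K A W (Suc i) *v vec_cols (graph_cnn a K A W X i)"
  have relu: "prelu a t = (if t \<ge> 0 then 1 else a) * t" for t
    using assms by (cases "t \<ge> 0") (auto simp: prelu_def max_def mult_le_cancel_right1 mult_le_cancel_right2)
  have "vec_cols (graph_cnn a K A W X (Suc i)) = (\<chi> p. prelu a (v $ p))"
    by (simp add: v_def layer_matrix_mult_vec_cols) (simp add: vec_cols_def vec_eq_iff)
  also have "\<dots> = mask_matrix a K A W X (Suc i) *v v"
  proof -
    have "(mask_matrix a K A W X (Suc i) *v v) $ p = (if v $ p \<ge> 0 then 1 else a) * v $ p" for p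
    proof -
      have "mask_matrix a K A W X (Suc i) =
          (\<chi> p q. if p = q then (if v $ p \<ge> 0 then 1 else a) else 0)"
        unfolding mask_matrix_def v_def diff_Suc_1 ..
      then show ?thesis
        by (simp add: matrix_vector_mult_def if_distrib[of "\<lambda>x. x * _"] cong: if_cong)
    qed
    then show ?thesis by (simp add: vec_eq_iff relu)
  qed
  finally show ?thesis by (simp add: v_def matrix_vector_mul_assoc)
qed

end

theory Submission
  imports Defs
begin

text \<open>
  On each layer the network acts on the vectorised features as the matrix
  \<open>mask_matrix \<dots> ** layer_matrix \<dots>\<close>, whose operator norm is its largest singular value, so the
  \<open>l\<close>-th output has norm at most \<open>s ^ l\<close> times the norm of the input. The inputs are
  bounded and the nonzero values of the alphabet are bounded away from \<open>0\<close>; hence beyond some layer,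
  the same for all inputs, the output is exactly \<open>0\<close>, and a constant carries no information.
\<close>

lemma inner_transpose_mult_self:
  fixes M :: "real^'m^'k"
  shows "((transpose M ** M) *v u) \<bullet> w = (M *v u) \<bullet> (M *v w)"
  by (metis dot_lmul_matrix matrix_vector_mul_assoc transpose_matrix_vector)

text \<open>\<open>transpose M ** M\<close> is symmetric, so eigenvectors for distinct eigenvalues
  are orthogonal, hence independent, and a finite-dimensional space holds only finitely many.
  Finiteness is what gives \<open>Max (singular_values M)\<close> its meaning.\<close>

lemma finite_singular_values:
  fixes M :: "real^'m^'k"
  shows "finite (singular_values M)"
proof -
  define E where "E = {\<mu>. \<exists>v. v \<noteq> 0 \<and> (transpose M ** M) *v v = \<mu> *\<^sub>R v}"
  have "\<forall>\<mu>\<in>E. \<exists>v. v \<noteq> 0 \<and> (transpose M ** M) *v v = \<mu> *\<^sub>R v"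
    unfolding E_def by auto
  then obtain f where f0: "\<And>\<mu>. \<mu> \<in> E \<Longrightarrow> f \<mu> \<noteq> 0"
    and f: "\<And>\<mu>. \<mu> \<in> E \<Longrightarrow> (transpose M ** M) *v f \<mu> = \<mu> *\<^sub>R f \<mu>"
    by metis
  have orth: "f \<mu> \<bullet> f \<nu> = 0" if "\<mu> \<in> E" "\<nu> \<in> E" "\<mu> \<noteq> \<nu>" for \<mu> \<nu>
  proof -
    \<comment> \<open>Both sides equal the inner product of \<open>M *v f \<mu>\<close> and
      \<open>M *v f \<nu>\<close>.\<close>
    have "\<mu> * (f \<mu> \<bullet> f \<nu>) = \<nu> * (f \<nu> \<bullet> f \<mu>)"
      using inner_transpose_mult_self[of M "f \<mu>" "f \<nu>"] inner_transpose_mult_self[of M "f \<nu>" "f \<mu>"] that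
      by (simp add: f inner_commute)
    then show ?thesis
      using that(3) by (simp add: inner_commute)
  qed
  have "pairwise orthogonal (f ` E)"
    by (auto simp: pairwise_def orthogonal_def intro!: orth)
  moreover have "0 \<notin> f ` E"
    using f0 by auto
  ultimately have "finite (f ` E)"
    by (intro finiteI_independent pairwise_orthogonal_independent)
  \<comment> \<open>A vector chosen for two distinct eigenvalues would be orthogonal to itself,
    hence zero.\<close>
  moreover have "inj_on f E"
    by (metis f0 inj_onI inner_eq_zero_iff orth)
  ultimately have "finite E"
    by (metis finite_imageD)
  moreover have "singular_values M = sqrt ` E"
    unfolding singular_values_def E_def by auto
  ultimately show ?thesis
    by simp
qed

text \<open>First-order condition at the minimum \<open>t = 0\<close>: for small \<open>t\<close> of
  sign opposite to \<open>c\<close> the linear term would win.\<close>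

lemma quadratic_nonneg_imp_linear_zero:
  fixes c q :: real
  assumes "\<And>t. 0 \<le> 2 * t * c + t\<^sup>2 * q"
  shows "c = 0"
proof (rule ccontr)
  assume "c \<noteq> 0"
  \<comment> \<open>At \<open>t = - c / k\<close> the form equals
    \<open>t\<^sup>2 * (q - 2 * k)\<close>; this \<open>k\<close> makes the factor negative whatever
    the sign of \<open>q\<close>.\<close>
  define k where "k = \<bar>q\<bar> + 1"
  define t where "t = - c / k"
  have "0 < k" "q - 2 * k < 0"
    by (auto simp: k_def)
  then have "t \<noteq> 0" "c = - t * k"
    using \<open>c \<noteq> 0\<close> by (auto simp: t_def)
  then have "2 * t * c + t\<^sup>2 * q = t\<^sup>2 * (q - 2 * k)"
    by (simp add: power2_eq_square algebra_simps)
  also have "\<dots> < 0"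
    using \<open>t \<noteq> 0\<close> \<open>q - 2 * k < 0\<close> by (simp add: mult_pos_neg)
  finally show False
    using assms[of t] by simp
qed

text \<open>
  A maximiser \<open>u\<close> of \<open>norm (M *v u)\<close> on the unit sphere is an eigenvector of \<open>transpose M ** M\<close>:
  it minimises the quadratic form \<open>norm (M *v u)\<^sup>2 * norm v\<^sup>2 - norm (M *v v)\<^sup>2\<close>.
\<close>

lemma singular_value_dominating:
  fixes M :: "real^'m^'k"
  obtains r where "r \<in> singular_values M" "0 \<le> r" "\<And>v. norm (M *v v) \<le> r * norm v"
proof -
  have "sphere (0 :: real^'m) 1 \<noteq> {}"
    by simp
  moreover have "continuous_on (sphere 0 1) (\<lambda>v. norm (M *v v))"
    by (intro continuous_intros matrix_vector_mult_linear_continuous_on)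
  ultimately obtain u where u: "norm u = 1"
    and max: "\<And>v. norm v = 1 \<Longrightarrow> norm (M *v v) \<le> norm (M *v u)"
    using continuous_attains_sup[OF compact_sphere] by (metis dist_0_norm mem_sphere)
  define r where "r = norm (M *v u)"
  have bound: "norm (M *v v) \<le> r * norm v" for v
  proof (cases "v = 0")
    case False
    then have "norm (M *v (v /\<^sub>R norm v)) \<le> r"
      unfolding r_def by (intro max) simp
    then show ?thesis
      using False by (simp add: matrix_vector_mult_scaleR field_simps)
  qed simp
  define \<mu> where "\<mu> = (M *v u) \<bullet> (M *v u)"
  have \<mu>: "r\<^sup>2 = \<mu>"
    by (simp add: r_def \<mu>_def power2_norm_eq_inner)
  have "u \<bullet> u = 1"
    using u by (simp add: norm_eq_1)
  have nonneg: "0 \<le> \<mu> * (v \<bullet> v) - (M *v v) \<bullet> (M *v v)" for v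
    using power_mono[OF bound[of v], of 2]
    by (simp add: power_mult_distrib \<mu> flip: power2_norm_eq_inner)
  have "\<mu> * (u \<bullet> w) - (M *v u) \<bullet> (M *v w) = 0" for w
  proof (rule quadratic_nonneg_imp_linear_zero)
    \<comment> \<open>This is the nonnegative form at \<open>u + t *\<^sub>R w\<close>, whose
      constant term vanishes because \<open>u\<close> is a unit vector attaining the
      maximum.\<close>
    fix t :: real
    show "0 \<le> 2 * t * (\<mu> * (u \<bullet> w) - (M *v u) \<bullet> (M *v w))
        + t\<^sup>2 * (\<mu> * (w \<bullet> w) - (M *v w) \<bullet> (M *v w))"
      using nonneg[of "u + t *\<^sub>R w"] \<mu>_def[symmetric] \<open>u \<bullet> u = 1\<close>
      by (simp add: matrix_vector_right_distrib matrix_vector_mult_scaleR inner_add_left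
          inner_add_right inner_commute power2_eq_square algebra_simps)
  qed
  then have "((transpose M ** M) *v u - \<mu> *\<^sub>R u) \<bullet> w = 0" for w
    by (simp add: inner_diff_left inner_transpose_mult_self)
  then have "(transpose M ** M) *v u = \<mu> *\<^sub>R u"
    by (metis eq_iff_diff_eq_0 inner_eq_zero_iff)
  moreover have "u \<noteq> 0"
    using u by auto
  ultimately have "sqrt (r\<^sup>2) \<in> singular_values M"
    unfolding singular_values_def \<mu> by blast
  then have "r \<in> singular_values M"
    by (simp add: r_def)
  then show ?thesis
    using that bound by (simp add: r_def)
qed

lemma Max_singular_values_nonneg:
  fixes M :: "real^'m^'k"
  shows "0 \<le> Max (singular_values M)"
  by (metis Max_ge finite_singular_values order_trans singular_value_dominating)

lemma norm_mult_le_Max_singular_values: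
  fixes M :: "real^'m^'k"
  shows "norm (M *v v) \<le> Max (singular_values M) * norm v"
proof -
  obtain r where r: "r \<in> singular_values M" "norm (M *v v) \<le> r * norm v"
    by (metis singular_value_dominating)
  have "r * norm v \<le> Max (singular_values M) * norm v"
    using r(1) by (intro mult_right_mono Max_ge finite_singular_values) auto
  then show ?thesis
    using r(2) by simp
qed

text \<open>The masks depend on the input, but once \<open>X\<close> is fixed each layer is
  multiplication by a fixed matrix along the trajectory of \<open>X\<close>, so the layer bounds
  multiply.\<close>

lemma norm_graph_cnn_le:
  assumes "0 < a" "a < 1" and s: "\<And>i. 1 \<le> i \<Longrightarrow> layer_sigma a K A W X i \<le> s"
  shows "norm (vec_cols (graph_cnn a K A W X l)) \<le> s ^ l * norm (vec_cols X)"
proof (induction l)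
  case (Suc l)
  have "0 \<le> s"
    using s[of 1] Max_singular_values_nonneg unfolding layer_sigma_def
    by (metis le_refl order_trans)
  have "norm (vec_cols (graph_cnn a K A W X (Suc l)))
      \<le> layer_sigma a K A W X (Suc l) * norm (vec_cols (graph_cnn a K A W X l))"
    unfolding vec_cols_graph_cnn_Suc[OF assms(1,2)] layer_sigma_def
    by (rule norm_mult_le_Max_singular_values)
  also have "\<dots> \<le> s * (s ^ l * norm (vec_cols X))"
    using \<open>0 \<le> s\<close> by (intro mult_mono Suc.IH s) auto
  finally show ?case
    by (simp add: mult.assoc)
qed simp

text \<open>With \<open>Y\<close> constant the joint law is the product of the marginals, and the
  divergence of a measure from itself is zero.\<close>

lemma (in information_space) mutual_information_const_eq_0:
  assumes X: "random_variable S X" and c: "c \<in> space T"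
    and Y: "\<And>\<omega>. \<omega> \<in> space M \<Longrightarrow> Y \<omega> = c"
  shows "mutual_information b S T X Y = 0"
proof -
  have rvY: "random_variable T Y"
    using c Y by (subst measurable_cong[where g = "\<lambda>_. c"]) auto
  interpret X: prob_space "distr M S X"
    by (rule prob_space_distr[OF X])
  interpret Y: prob_space "distr M T Y"
    by (rule prob_space_distr[OF rvY])
  have XY: "(\<lambda>\<omega>. (X \<omega>, Y \<omega>)) \<in> M \<rightarrow>\<^sub>M S \<Otimes>\<^sub>M T"
    using X rvY by measurable
  interpret XY: prob_space "distr M (S \<Otimes>\<^sub>M T) (\<lambda>\<omega>. (X \<omega>, Y \<omega>))"
    by (rule prob_space_distr[OF XY])
  have "distr M S X \<Otimes>\<^sub>M distr M T Y = distr M (S \<Otimes>\<^sub>M T) (\<lambda>\<omega>. (X \<omega>, Y \<omega>))"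
  proof (rule pair_measure_eqI)
    fix A B assume "A \<in> sets (distr M S X)" "B \<in> sets (distr M T Y)"
    then have AB: "A \<in> sets S" "B \<in> sets T"
      by auto
    \<comment> \<open>The law of \<open>Y\<close> is a point mass at \<open>c\<close>, so both sides
      of the rectangle identity depend only on whether \<open>c\<close> lies in
      \<open>B\<close>.\<close>
    have "Y -` B \<inter> space M = (if c \<in> B then space M else {})"
      "(\<lambda>\<omega>. (X \<omega>, Y \<omega>)) -` (A \<times> B) \<inter> space M = (if c \<in> B then X -` A \<inter> space M else {})"
      using Y by auto
    then show "emeasure (distr M S X) A * emeasure (distr M T Y) B
        = emeasure (distr M (S \<Otimes>\<^sub>M T) (\<lambda>\<omega>. (X \<omega>, Y \<omega>))) (A \<times> B)"
      using AB X rvY XY by (simp add: emeasure_distr emeasure_space_1)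
  qed (auto intro: X.sigma_finite_measure_axioms Y.sigma_finite_measure_axioms)
  then show ?thesis
    unfolding mutual_information_def by (metis XY.KL_same_eq_0)
qed

lemma continuous_on_vec_cols: "continuous_on U (vec_cols :: real^'d^'n \<Rightarrow> _)"
  unfolding vec_cols_def by (intro continuous_intros)

lemma finite_vectors_over_alphabet:
  assumes "finite S"
  shows "finite {v :: 'a^'i::finite. \<forall>p. v $ p \<in> S}"
proof (rule finite_subset)
  show "{v :: 'a^'i. \<forall>p. v $ p \<in> S} \<subseteq> vec_lambda ` (UNIV \<rightarrow>\<^sub>E S)"
    by (auto intro!: image_eqI[where x = "vec_nth _"])
  show "finite (vec_lambda ` (UNIV \<rightarrow>\<^sub>E S) :: ('a^'i) set)"
    using assms by (intro finite_imageI finite_PiE) auto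
qed

theorem theorem3:
  fixes M :: "'s measure"
    and X :: "'s \<Rightarrow> real^'d^'n"
    and A :: "real^'n^'n"
    and Ak :: "nat \<Rightarrow> real^'n^'n"
    and W :: "nat \<Rightarrow> nat \<Rightarrow> real^'d^'d"
    and K :: nat and a b s :: real
    and S :: "real set"
  defines "x \<equiv> \<lambda>\<omega>. vec_cols (X \<omega>)"
    and "y \<equiv> \<lambda>l \<omega>. vec_cols (graph_cnn a K Ak W (X \<omega>) l)"
    and "s \<equiv> SUP (i, \<omega>) \<in> {1..} \<times> space M. layer_sigma a K Ak W (X \<omega>) i"
  assumes "prob_space M" and "b > 1"
    and "X \<in> borel_measurable M"
    and "undirected_adjacency A"
    and "K \<ge> 1"
    and "A = (\<Sum>k = 1..K. Ak k)"
    and "0 < a" and "a < 1"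
    and "finite S" and "\<And>l \<omega> p. \<omega> \<in> space M \<Longrightarrow> y l \<omega> $ p \<in> S"
    and "bdd_above ((\<lambda>(i, \<omega>). layer_sigma a K Ak W (X \<omega>) i) ` ({1..} \<times> space M))"
    and "s < 1"
  shows "(\<lambda>l. shannon_mutual_information M b x (y l)) \<in> O(\<lambda>l. s ^ l) \<and>
    (\<lambda>l. shannon_mutual_information M b x (y l)) \<longlonglongrightarrow> 0"
proof -
  interpret prob_space M
    by fact
  interpret information_space M b
    by unfold_locales fact
  note yS = assms(13)
  \<comment> \<open>Layer \<open>0\<close> is the input, so the alphabet hypothesis on the outputs
    also makes the range of \<open>x\<close> finite.\<close>
  have y0: "y 0 = x"
    by (simp add: x_def y_def)
  have sigma_le: "layer_sigma a K Ak W (X \<omega>) i \<le> s" if "\<omega> \<in> space M" "1 \<le> i" for \<omega> i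
    unfolding s_def using that by (intro cSUP_upper2[OF assms(14), of "(i, \<omega>)"]) auto
  have decay: "norm (y l \<omega>) \<le> s ^ l * norm (x \<omega>)" if "\<omega> \<in> space M" for l \<omega>
    unfolding x_def y_def using that assms(10,11) by (intro norm_graph_cnn_le sigma_le)
  obtain \<omega>0 where "\<omega>0 \<in> space M"
    using not_empty by auto
  then have "0 \<le> s"
    using order_trans[OF Max_singular_values_nonneg sigma_le[unfolded layer_sigma_def, of \<omega>0 1]] by simp
  have fin: "finite (x ` space M)"
    by (rule finite_subset[OF _ finite_vectors_over_alphabet[OF assms(12)]])
      (use yS[of _ 0] in \<open>auto simp: y0\<close>)
  then have "bounded (x ` space M)"
    by (rule finite_imp_bounded)
  then obtain C where C: "\<And>\<omega>. \<omega> \<in> space M \<Longrightarrow> norm (x \<omega>) \<le> C"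
    by (auto simp: bounded_iff)
  \<comment> \<open>\<open>m\<close> is a gap around \<open>0\<close> in the alphabet: an entry
    smaller than \<open>m\<close> in absolute value must be exactly \<open>0\<close>.\<close>
  obtain m where "0 < m" and m: "\<And>t. t \<in> S \<Longrightarrow> t \<noteq> 0 \<Longrightarrow> m \<le> \<bar>t\<bar>"
    using finite_set_avoid[OF assms(12), of 0] by auto
  \<comment> \<open>\<open>C\<close> bounds all inputs at once, so the layer from which the outputs
    vanish is the same for every \<open>\<omega>\<close>.\<close>
  have "(\<lambda>l. s ^ l * C) \<longlonglongrightarrow> 0"
    using \<open>0 \<le> s\<close> \<open>s < 1\<close> by (intro tendsto_mult_left_zero LIMSEQ_power_zero) simp
  then have "\<forall>\<^sub>F l in sequentially. s ^ l * C < m"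
    using \<open>0 < m\<close> by (rule order_tendstoD)
  then have ev: "\<forall>\<^sub>F l in sequentially. shannon_mutual_information M b x (y l) = 0"
  proof eventually_elim
    case (elim l)
    have zero: "y l \<omega> = 0" if \<omega>: "\<omega> \<in> space M" for \<omega>
    proof -
      have "y l \<omega> $ p = 0" for p
      proof (rule ccontr)
        assume "y l \<omega> $ p \<noteq> 0"
        then have "m \<le> \<bar>y l \<omega> $ p\<bar>"
          by (intro m yS \<omega>)
        also have "\<dots> \<le> norm (y l \<omega>)"
          by (rule component_le_norm_cart)
        also have "\<dots> \<le> s ^ l * norm (x \<omega>)"
          by (rule decay[OF \<omega>])
        also have "\<dots> \<le> s ^ l * C"
          using \<open>0 \<le> s\<close> by (intro mult_left_mono C \<omega>) simp
        finally show False
          using elim by simp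
      qed
      then show ?thesis
        by (simp add: vec_eq_iff)
    qed
    have "x \<in> borel_measurable M"
      unfolding x_def using assms(6)
      by (rule borel_measurable_continuous_on[OF continuous_on_vec_cols])
    then have "simple_function M x"
      using fin by (rule simple_function_borel_measurable)
    then have "random_variable (count_space (x ` space M)) x"
      using fin by (auto simp: simple_function_def measurable_count_space_eq2)
    \<comment> \<open>The target space is the range of \<open>y l\<close>, so \<open>0\<close> has
      to be attained; the sample point \<open>\<omega>0\<close> shows this.\<close>
    moreover have "0 \<in> space (count_space (y l ` space M))"
      using zero[OF \<open>\<omega>0 \<in> space M\<close>] \<open>\<omega>0 \<in> space M\<close> by (force simp: image_iff)
    ultimately show ?case
      using zero by (rule mutual_information_const_eq_0)
  qed
  \<comment> \<open>An eventually zero sequence is dominated with any nonnegative constant, even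
    when \<open>s = 0\<close>.\<close>
  then have "(\<lambda>l. shannon_mutual_information M b x (y l)) \<in> O(\<lambda>l. s ^ l)"
    by (intro bigoI[of _ 1]) (auto elim!: eventually_mono)
  with ev show ?thesis
    by (simp add: tendsto_eventually)
qed

end
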